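(* Let $\gamma\in[0,1]$, $x\in\mathcal{X}$, and let $C_\gamma(x)$ be the $\gamma$-relative surprise region for $\tau=\Upsilon(\theta)$. Then $BF_{C_\gamma(x)}(x)>1$ and $RB_{C_\gamma(x)}(x)>1$.
   Context: Setting: $\{f_\theta:\theta\in\Theta\}$ is a statistical model, $f_\theta$ being the density of a probability measure $P_\theta$ with respect to a support measure $\mu$ on the sample space $\mathcal{X}$. $\Pi$ is a proper prior (a probability measure) on $\Theta$, with density $\pi$ with respect to a support measure $\upsilon$ on $\Theta$. The joint distribution of $(\theta,X)$ is $\theta\sim\Pi$, $X\mid\theta\sim P_\theta$. The parameter of interest is $\tau=\Upsilon(\theta)\in\mathcal{T}$; $\Pi_\Upsilon$ and $\Pi_\Upsilon(\cdot\mid x)$ are its marginal prior and posterior (given $X=x$) distributions, with densities $\pi_\Upsilon$ and $\pi_\Upsilon(\cdot\mid x)$ with respect to a support measure $\nu_{\mathcal{T}}$ on $\mathcal{T}$. It is assumed that $\pi_\Upsilon(\tau)>0$ for every $\tau\in\mathcal{T}$. The $\gamma$-relative surprise region is $$C_\gamma(x)=\left\{\tau_0\in\mathcal{T}:\Pi_\Upsilon\left(\left\{\tau:\frac{\pi_\Upsilon(\tau\mid x)}{\pi_\Upsilon(\tau)}>\frac{\pi_\Upsilon(\tau_0\mid x)}{\pi_\Upsilon(\tau_0)}\right\}\,\Big|\,x\right)\le\gamma\right\}.$$ For $C\subset\mathcal{T}$ the Bayes factor in favor of the true value of $\tau$ being in $C$ and the relative belief ratio of $C$ are $$BF_C(x)=\left\{\frac{\Pi_\Upsilon(C\mid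 x)}{1-\Pi_\Upsilon(C\mid x)}\right\}\left\{\frac{\Pi_\Upsilon(C)}{1-\Pi_\Upsilon(C)}\right\}^{-1},\qquad RB_C(x)=\frac{\Pi_\Upsilon(C\mid x)}{\Pi_\Upsilon(C)}.$$
   Formalization: Assumes the prior content of C_γ(x) lies strictly between 0 and 1 (at γ=1 the region is all of T and RB=1; at content 0 the ratios are 0/0), and that x has positive finite prior predictive density, so that the posterior exists. *)

theory Defs
  imports "HOL-Probability.Probability"
begin

text \<open>
  \<^term>\<open>\<upsilon>\<close> and \<^term>\<open>\<mu>\<close> are the support measures on the parameter space and the sample space (the
  spaces themselves are \<^term>\<open>space \<upsilon>\<close> and \<^term>\<open>space \<mu>\<close>), and \<^term>\<open>f \<theta> x\<close> is the density of
  \<open>P\<^sub>\<theta>\<close> at \<^term>\<open>x\<close>.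
\<close>

locale bayesian_model =
  fixes \<upsilon> :: "'p measure" and \<mu> :: "'x measure"
    and f :: "'p \<Rightarrow> 'x \<Rightarrow> real" and \<pi> :: "'p \<Rightarrow> real"
  assumes likelihood_measurable: "(\<lambda>(\<theta>, x). f \<theta> x) \<in> borel_measurable (\<upsilon> \<Otimes>\<^sub>M \<mu>)"
    and likelihood_nonneg: "\<And>\<theta> x. \<theta> \<in> space \<upsilon> \<Longrightarrow> x \<in> space \<mu> \<Longrightarrow> 0 \<le> f \<theta> x"
    and likelihood_prob: "\<And>\<theta>. \<theta> \<in> space \<upsilon> \<Longrightarrow> prob_space (density \<mu> (\<lambda>x. ennreal (f \<theta> x)))"
    and prior_measurable: "\<pi> \<in> borel_measurable \<upsilon>"
    and prior_nonneg: "\<And>\<theta>. \<theta> \<in> space \<upsilon> \<Longrightarrow> 0 \<le> \<pi> \<theta>"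
    and prior_prob: "prob_space (density \<upsilon> (\<lambda>\<theta>. ennreal (\<pi> \<theta>)))"

definition prior :: "'p measure \<Rightarrow> ('p \<Rightarrow> real) \<Rightarrow> 'p measure" where
  "prior \<upsilon> \<pi> = density \<upsilon> (\<lambda>\<theta>. ennreal (\<pi> \<theta>))"

definition joint ::
  "'p measure \<Rightarrow> 'x measure \<Rightarrow> ('p \<Rightarrow> 'x \<Rightarrow> real) \<Rightarrow> ('p \<Rightarrow> real) \<Rightarrow> ('p \<times> 'x) measure" where
  "joint \<upsilon> \<mu> f \<pi> = density (\<upsilon> \<Otimes>\<^sub>M \<mu>) (\<lambda>(\<theta>, x). ennreal (\<pi> \<theta> * f \<theta> x))"

definition predictive ::
  "'p measure \<Rightarrow> ('p \<Rightarrow> 'x \<Rightarrow> real) \<Rightarrow> ('p \<Rightarrow> real) \<Rightarrow> 'x \<Rightarrow> ennreal" where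
  "predictive \<upsilon> f \<pi> x = (\<integral>\<^sup>+ \<theta>. ennreal (\<pi> \<theta> * f \<theta> x) \<partial>\<upsilon>)"

text \<open>
  The posterior is a probability measure exactly at those \<^term>\<open>x\<close> whose prior predictive density is
  neither \<open>0\<close> nor \<open>\<infinity>\<close>; at other \<^term>\<open>x\<close> the value below is meaningless.
\<close>

definition posterior ::
  "'p measure \<Rightarrow> ('p \<Rightarrow> 'x \<Rightarrow> real) \<Rightarrow> ('p \<Rightarrow> real) \<Rightarrow> 'x \<Rightarrow> 'p measure" where
  "posterior \<upsilon> f \<pi> x = density \<upsilon> (\<lambda>\<theta>. ennreal (\<pi> \<theta> * f \<theta> x) / predictive \<upsilon> f \<pi> x)"

lemma prob_space_posterior:
  assumes "bayesian_model \<upsilon> \<mu> f \<pi>" "x \<in> space \<mu>"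
    and m: "0 < predictive \<upsilon> f \<pi> x" "predictive \<upsilon> f \<pi> x < \<infinity>"
  shows "prob_space (posterior \<upsilon> f \<pi> x)"
proof -
  interpret bayesian_model \<upsilon> \<mu> f \<pi> by fact
  have [measurable]: "(\<lambda>\<theta>. f \<theta> x) \<in> borel_measurable \<upsilon>"
    using measurable_compose[OF measurable_Pair2'[OF assms(2)] likelihood_measurable] by simp
  note prior_measurable[measurable]
  show ?thesis
    unfolding posterior_def
  proof (rule prob_spaceI)
    have "emeasure (density \<upsilon> (\<lambda>\<theta>. ennreal (\<pi> \<theta> * f \<theta> x) / predictive \<upsilon> f \<pi> x)) (space \<upsilon>)
        = (\<integral>\<^sup>+ \<theta>. ennreal (\<pi> \<theta> * f \<theta> x) / predictive \<upsilon> f \<pi> x \<partial>\<upsilon>)"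
      by (subst emeasure_density) (auto intro!: nn_integral_cong simp: indicator_def)
    also have "\<dots> = predictive \<upsilon> f \<pi> x / predictive \<upsilon> f \<pi> x"
      unfolding predictive_def by (rule nn_integral_divide) measurable
    also have "\<dots> = 1" using m by (simp add: ennreal_divide_self)
    finally show "emeasure (density \<upsilon> (\<lambda>\<theta>. ennreal (\<pi> \<theta> * f \<theta> x) / predictive \<upsilon> f \<pi> x))
        (space (density \<upsilon> (\<lambda>\<theta>. ennreal (\<pi> \<theta> * f \<theta> x) / predictive \<upsilon> f \<pi> x))) = 1" by simp
  qed
qed

lemma posterior_disintegrates_joint:
  assumes "bayesian_model \<upsilon> \<mu> f \<pi>" and "sigma_finite_measure \<upsilon>" "sigma_finite_measure \<mu>"
    and A[measurable]: "A \<in> sets \<upsilon>" and B[measurable]: "B \<in> sets \<mu>"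
  shows "emeasure (joint \<upsilon> \<mu> f \<pi>) (A \<times> B)
    = (\<integral>\<^sup>+ x\<in>B. emeasure (posterior \<upsilon> f \<pi> x) A \<partial>density \<mu> (predictive \<upsilon> f \<pi>))"
proof -
  interpret bayesian_model \<upsilon> \<mu> f \<pi> by fact
  interpret U: sigma_finite_measure \<upsilon> by fact
  interpret M: sigma_finite_measure \<mu> by fact
  interpret pair_sigma_finite \<upsilon> \<mu> ..
  note likelihood_measurable[measurable] prior_measurable[measurable]
  let ?g = "\<lambda>\<theta> x. ennreal (\<pi> \<theta> * f \<theta> x)" and ?m = "predictive \<upsilon> f \<pi>"
  have g[measurable]: "(\<lambda>(\<theta>, x). ?g \<theta> x) \<in> borel_measurable (\<upsilon> \<Otimes>\<^sub>M \<mu>)"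
    by measurable
  have g': "(\<lambda>(x, \<theta>). ?g \<theta> x) \<in> borel_measurable (\<mu> \<Otimes>\<^sub>M \<upsilon>)"
    by measurable
  have m[measurable]: "?m \<in> borel_measurable \<mu>"
    unfolding predictive_def using U.borel_measurable_nn_integral[OF g'] by simp
  have gx: "(\<lambda>\<theta>. ?g \<theta> x) \<in> borel_measurable \<upsilon>" if "x \<in> space \<mu>" for x
    using measurable_compose[OF measurable_Pair2'[OF that] g] by simp
  have "(\<integral>\<^sup>+ x. ?m x \<partial>\<mu>) = (\<integral>\<^sup>+ \<theta>. \<integral>\<^sup>+ x. ?g \<theta> x \<partial>\<mu> \<partial>\<upsilon>)"
    unfolding predictive_def using Fubini'[OF g] by simp
  also have "\<dots> = (\<integral>\<^sup>+ \<theta>. ennreal (\<pi> \<theta>) \<partial>\<upsilon>)"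
  proof (rule nn_integral_cong)
    fix \<theta> assume t: "\<theta> \<in> space \<upsilon>"
    have [measurable]: "(\<lambda>x. f \<theta> x) \<in> borel_measurable \<mu>"
      using measurable_compose[OF measurable_Pair1'[OF t] likelihood_measurable] by simp
    have "(\<integral>\<^sup>+ x. ?g \<theta> x \<partial>\<mu>) = (\<integral>\<^sup>+ x. ennreal (\<pi> \<theta>) * ennreal (f \<theta> x) \<partial>\<mu>)"
      using t by (intro nn_integral_cong) (simp add: ennreal_mult likelihood_nonneg prior_nonneg)
    also have "\<dots> = ennreal (\<pi> \<theta>) * (\<integral>\<^sup>+ x. ennreal (f \<theta> x) \<partial>\<mu>)"
      by (rule nn_integral_cmult) measurable
    also have "(\<integral>\<^sup>+ x. ennreal (f \<theta> x) \<partial>\<mu>) = 1"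
      using prob_space.emeasure_space_1[OF likelihood_prob[OF t]]
      by (simp add: emeasure_density cong: nn_integral_cong)
    finally show "(\<integral>\<^sup>+ x. ?g \<theta> x \<partial>\<mu>) = ennreal (\<pi> \<theta>)" by simp
  qed
  also have "\<dots> = 1"
    using prob_space.emeasure_space_1[OF prior_prob]
    by (simp add: emeasure_density cong: nn_integral_cong)
  finally have fin: "AE x in \<mu>. ?m x \<noteq> \<infinity>"
    by (intro nn_integral_noteq_infinite) simp_all
  have post: "emeasure (posterior \<upsilon> f \<pi> x) A = (\<integral>\<^sup>+ \<theta>. ?g \<theta> x * indicator A \<theta> \<partial>\<upsilon>) / ?m x"
    if [simp]: "x \<in> space \<mu>" for x
  proof -
    have "emeasure (posterior \<upsilon> f \<pi> x) A = (\<integral>\<^sup>+ \<theta>. ?g \<theta> x * indicator A \<theta> / ?m x \<partial>\<upsilon>)"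
      unfolding posterior_def using gx[OF that]
      by (subst emeasure_density)
        (auto intro!: nn_integral_cong simp: indicator_def)
    also have "\<dots> = (\<integral>\<^sup>+ \<theta>. ?g \<theta> x * indicator A \<theta> \<partial>\<upsilon>) / ?m x"
      by (intro nn_integral_divide borel_measurable_times_ennreal borel_measurable_indicator
          gx[OF that] A)
    finally show ?thesis .
  qed
  have gA: "(\<lambda>(x, \<theta>). ?g \<theta> x * indicator A \<theta>) \<in> borel_measurable (\<mu> \<Otimes>\<^sub>M \<upsilon>)"
    using g' by measurable
  have I[measurable]: "(\<lambda>x. \<integral>\<^sup>+ \<theta>. ?g \<theta> x * indicator A \<theta> \<partial>\<upsilon>) \<in> borel_measurable \<mu>"
    using U.borel_measurable_nn_integral[OF gA] by simp
  have h: "(\<lambda>(\<theta>, x). ?g \<theta> x * indicator A \<theta> * indicator B x) \<in> borel_measurable (\<upsilon> \<Otimes>\<^sub>M \<mu>)"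
    by measurable
  have "emeasure (joint \<upsilon> \<mu> f \<pi>) (A \<times> B)
      = (\<integral>\<^sup>+ z. (case z of (\<theta>, x) \<Rightarrow> ?g \<theta> x * indicator A \<theta> * indicator B x) \<partial>(\<upsilon> \<Otimes>\<^sub>M \<mu>))"
    unfolding joint_def
    by (subst emeasure_density) (auto intro!: nn_integral_cong simp: indicator_def)
  also have "\<dots> = (\<integral>\<^sup>+ x. \<integral>\<^sup>+ \<theta>. ?g \<theta> x * indicator A \<theta> * indicator B x \<partial>\<upsilon> \<partial>\<mu>)"
    using nn_integral_snd[OF h] by simp
  also have "\<dots> = (\<integral>\<^sup>+ x. ?m x * ((\<integral>\<^sup>+ \<theta>. ?g \<theta> x * indicator A \<theta> \<partial>\<upsilon>) / ?m x * indicator B x) \<partial>\<mu>)"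
  proof (rule nn_integral_cong_AE, use fin AE_space in eventually_elim)
    fix x assume mx: "?m x \<noteq> \<infinity>" and x: "x \<in> space \<mu>"
    let ?I = "\<integral>\<^sup>+ \<theta>. ?g \<theta> x * indicator A \<theta> \<partial>\<upsilon>"
    have "?I \<le> ?m x"
      unfolding predictive_def by (intro nn_integral_mono) (simp add: indicator_def)
    then have "?m x * (?I / ?m x) = ?I"
      using mx by (cases "?m x = 0")
        (simp_all add: ennreal_times_divide mult.commute[of "?m x"] ennreal_mult_divide_eq)
    then have "?m x * (?I / ?m x * indicator B x) = ?I * indicator B x"
      by (simp only: mult.assoc[symmetric])
    moreover have "(\<integral>\<^sup>+ \<theta>. ?g \<theta> x * indicator A \<theta> * indicator B x \<partial>\<upsilon>) = ?I * indicator B x"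
      by (intro nn_integral_multc borel_measurable_times_ennreal borel_measurable_indicator gx[OF x] A)
    ultimately show "(\<integral>\<^sup>+ \<theta>. ?g \<theta> x * indicator A \<theta> * indicator B x \<partial>\<upsilon>)
        = ?m x * (?I / ?m x * indicator B x)" by simp
  qed
  also have "\<dots> = (\<integral>\<^sup>+ x. (\<integral>\<^sup>+ \<theta>. ?g \<theta> x * indicator A \<theta> \<partial>\<upsilon>) / ?m x * indicator B x
      \<partial>density \<mu> ?m)"
    by (rule nn_integral_density[symmetric]) measurable
  also have "\<dots> = (\<integral>\<^sup>+ x\<in>B. emeasure (posterior \<upsilon> f \<pi> x) A \<partial>density \<mu> ?m)"
    by (intro nn_integral_cong) (simp add: post)
  finally show ?thesis .
qed

definition marginal :: "'p measure \<Rightarrow> 't measure \<Rightarrow> ('p \<Rightarrow> 't) \<Rightarrow> 't measure" where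
  "marginal M \<nu> \<Upsilon> = distr M \<nu> \<Upsilon>"

text \<open>
  A real-valued, everywhere nonnegative version of the density of \<^term>\<open>M\<close> with respect to
  \<^term>\<open>\<nu>\<close>.
\<close>

definition is_density :: "'t measure \<Rightarrow> 't measure \<Rightarrow> ('t \<Rightarrow> real) \<Rightarrow> bool" where
  "is_density \<nu> M p \<longleftrightarrow>
     p \<in> borel_measurable \<nu> \<and> (\<forall>\<tau>\<in>space \<nu>. 0 \<le> p \<tau>) \<and> M = density \<nu> (\<lambda>\<tau>. ennreal (p \<tau>))"

text \<open>\<^term>\<open>Q\<close> is the marginal posterior, \<^term>\<open>q\<close> its density, and \<^term>\<open>p\<close> the marginal prior density.\<close>

definition relative_surprise_region ::
  "'t measure \<Rightarrow> ('t \<Rightarrow> real) \<Rightarrow> ('t \<Rightarrow> real) \<Rightarrow> real \<Rightarrow> 't set" where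
  "relative_surprise_region Q q p \<gamma> =
     {\<tau>0 \<in> space Q. measure Q {\<tau> \<in> space Q. q \<tau> / p \<tau> > q \<tau>0 / p \<tau>0} \<le> \<gamma>}"

text \<open>
  Values are taken in \<open>[0, \<infinity>]\<close>, where \<^prop>\<open>a / 0 = (\<infinity> :: ennreal)\<close> for \<^prop>\<open>0 < (a :: ennreal)\<close>. So
  posterior odds are \<open>\<infinity>\<close> when the posterior content is \<open>1\<close>. The ratios are meaningless when \<^term>\<open>P C\<close>
  is \<open>0\<close> (they become \<open>0/0\<close>), and so is the Bayes factor when it is \<open>1\<close>.
\<close>

definition bayes_factor :: "'t measure \<Rightarrow> 't measure \<Rightarrow> 't set \<Rightarrow> ennreal" where
  "bayes_factor P Q C =
     (emeasure Q C / (1 - emeasure Q C)) * inverse (emeasure P C / (1 - emeasure P C))"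

definition relative_belief_ratio :: "'t measure \<Rightarrow> 't measure \<Rightarrow> 't set \<Rightarrow> ennreal" where
  "relative_belief_ratio P Q C = emeasure Q C / emeasure P C"

end

theory Submission
  imports Defs
begin

text \<open>
  The region is an upper set for the ratio \<open>q / p\<close> of posterior to prior density. So either the ratio
  exceeds \<open>1\<close> throughout the region, or it is below \<open>1\<close> throughout the complement. Integrating the
  strict inequality over the region or over the complement, each of positive prior content, shows that
  the posterior content of the region is strictly larger than its prior content.
\<close>

text \<open>The larger the ratio at a point, the smaller the set of points that beat it, and so the
  smaller the posterior content compared with \<open>\<gamma>\<close>.\<close>

lemma relative_surprise_region_upper:
  assumes "finite_measure Q" and "(\<lambda>\<tau>. q \<tau> / p \<tau>) \<in> borel_measurable Q"
    and a: "a \<in> relative_surprise_region Q q p \<gamma>"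
    and b: "b \<in> space Q" "q a / p a \<le> q b / p b"
  shows "b \<in> relative_surprise_region Q q p \<gamma>"
proof -
  interpret finite_measure Q by fact
  note assms(2)[measurable]
  have "measure Q {\<tau> \<in> space Q. q \<tau> / p \<tau> > q b / p b}
      \<le> measure Q {\<tau> \<in> space Q. q \<tau> / p \<tau> > q a / p a}"
    using b(2) by (intro finite_measure_mono) auto
  then show ?thesis
    using a b(1) by (simp add: relative_surprise_region_def)
qed

text \<open>Pointwise strictness survives integration because \<open>A\<close> is not null and the
  smaller integral is finite; the larger one may be infinite.\<close>

lemma emeasure_density_strict_mono:
  fixes f g :: "'a \<Rightarrow> ennreal"
  assumes [measurable]: "f \<in> borel_measurable M" "g \<in> borel_measurable M" "A \<in> sets M"
    and less: "\<And>x. x \<in> A \<Longrightarrow> f x < g x"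
    and pos: "A \<notin> null_sets M" and fin: "emeasure (density M f) A \<noteq> \<infinity>"
  shows "emeasure (density M f) A < emeasure (density M g) A"
proof -
  have "(\<integral>\<^sup>+x. f x * indicator A x \<partial>M) < (\<integral>\<^sup>+x. g x * indicator A x \<partial>M)"
  proof (rule nn_integral_less)
    show "(\<integral>\<^sup>+x. f x * indicator A x \<partial>M) \<noteq> \<infinity>"
      using fin by (simp add: emeasure_density)
    show "AE x in M. f x * indicator A x \<le> g x * indicator A x"
      using less by (auto simp: indicator_def intro: less_imp_le)
    \<comment> \<open>The reverse inequality fails at each point of \<open>A\<close>, so it can hold
      almost everywhere only if \<open>A\<close> is null.\<close>
    have "x \<notin> A" if "g x * indicator A x \<le> f x * indicator A x" for x
      using that less[of x] by (auto simp: indicator_def split: if_splits)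
    then have "AE x in M. x \<notin> A" if "AE x in M. g x * indicator A x \<le> f x * indicator A x"
      using that by (rule eventually_mono[rotated])
    then show "\<not> (AE x in M. g x * indicator A x \<le> f x * indicator A x)"
      using pos AE_iff_null_sets[OF assms(3)] by blast
  qed simp_all
  then show ?thesis
    by (simp add: emeasure_density)
qed

lemma emeasure_density_null_set:
  assumes "f \<in> borel_measurable M" "A \<in> null_sets M"
  shows "emeasure (density M f) A = 0"
  using absolutely_continuousI_density[OF assms(1)] assms(2) by (auto simp: absolutely_continuous_def)

lemma emeasure_upper_set_less:
  fixes p q :: "'a \<Rightarrow> real"
  assumes "prob_space P" "prob_space Q"
    and p: "is_density M P p" "\<forall>\<tau>\<in>space M. 0 < p \<tau>" and q: "is_density M Q q"
    and upper: "\<And>a b. a \<in> C \<Longrightarrow> b \<in> space M \<Longrightarrow> q a / p a \<le> q b / p b \<Longrightarrow> b \<in> C"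
    and C: "0 < emeasure P C" "emeasure P C < 1"
  shows "emeasure P C < emeasure Q C"
proof -
  interpret P: prob_space P by fact
  interpret Q: prob_space Q by fact
  have [measurable]: "p \<in> borel_measurable M" "q \<in> borel_measurable M"
    and q0: "\<And>\<tau>. \<tau> \<in> space M \<Longrightarrow> 0 \<le> q \<tau>"
    and P: "P = density M (\<lambda>\<tau>. ennreal (p \<tau>))" and Q: "Q = density M (\<lambda>\<tau>. ennreal (q \<tau>))"
    using p q by (auto simp: is_density_def)
  \<comment> \<open>\<open>emeasure\<close> is 0 off the sigma-algebra, so positive prior content
    already makes \<open>C\<close> measurable.\<close>
  have [measurable]: "C \<in> sets M"
    using C(1) emeasure_notin_sets[of C P] by (cases "C \<in> sets M") (simp_all add: P)
  then have sub: "C \<subseteq> space M" and CP: "C \<in> sets P" and CQ: "C \<in> sets Q"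
    by (auto simp: P Q sets.sets_into_space)
  have space: "space P = space M" "space Q = space M"
    by (simp_all add: P Q)
  \<comment> \<open>\<open>P\<close> has a density with respect to \<open>M\<close>, so a set of
    nonzero prior content is not null in \<open>M\<close>, as the strict comparison
    requires.\<close>
  have not_null: "A \<notin> null_sets M" if "emeasure P A \<noteq> 0" for A
    using that emeasure_density_null_set[of "\<lambda>\<tau>. ennreal (p \<tau>)" M A] by (auto simp: P)
  show ?thesis
  proof (cases "\<exists>\<tau>\<in>space M - C. p \<tau> \<le> q \<tau>")
    case True
    then obtain b where b: "b \<in> space M" "b \<notin> C" "1 \<le> q b / p b"
      using p(2) by auto
    \<comment> \<open>A ratio of at most 1 at \<open>a\<close> would not exceed the ratio at
      \<open>b\<close>, and \<open>upper\<close> would then put \<open>b\<close> into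
      \<open>C\<close>.\<close>
    have "p a < q a" if "a \<in> C" for a
    proof -
      have "1 < q a / p a"
        using upper[OF that b(1)] b by force
      moreover have "0 < p a"
        using that sub p(2) by blast
      ultimately show ?thesis
        by (simp add: less_divide_eq)
    qed
    moreover have "0 \<le> p a" if "a \<in> C" for a
      using that sub p(2) by (auto intro: less_imp_le)
    ultimately show ?thesis
      using not_null[of C] C unfolding P Q
      by (intro emeasure_density_strict_mono) (auto simp: ennreal_less_iff)
  next
    case False
    \<comment> \<open>Now \<open>q\<close> is below \<open>p\<close> on the whole complement, which
      has positive prior content since that of \<open>C\<close> is below 1. Both total masses are 1,
      so a strict loss on the complement is a strict gain on \<open>C\<close>.\<close>
    have "emeasure P (space M - C) \<noteq> 0"
      using P.prob_compl[OF CP] C(2) by (simp add: space P.emeasure_eq_measure)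
    then have "emeasure Q (space M - C) < emeasure P (space M - C)"
      using False q0 Q.emeasure_finite[of "space M - C"] not_null[of "space M - C"] unfolding P Q
      by (intro emeasure_density_strict_mono) (auto simp: ennreal_less_iff not_le)
    then have "Q.prob (space M - C) < P.prob (space M - C)"
      by (simp add: P.emeasure_eq_measure Q.emeasure_eq_measure ennreal_less_iff)
    then have "P.prob C < Q.prob C"
      using P.prob_compl[OF CP] Q.prob_compl[OF CQ] by (simp add: space)
    then show ?thesis
      by (simp add: P.emeasure_eq_measure Q.emeasure_eq_measure ennreal_less_iff)
  qed
qed

text \<open>The odds \<open>t / (1 - t)\<close> increase strictly in \<open>t\<close>. The case
  \<open>b = 1\<close> stands apart because its odds are infinite.\<close>

lemma odds_ratio_gt_one:
  fixes a b :: ennreal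
  assumes "0 < a" "a < b" "b \<le> 1"
  shows "1 < (b / (1 - b)) * inverse (a / (1 - a))"
proof (cases "b = 1")
  case True
  \<comment> \<open>Finite odds of \<open>a\<close> have a nonzero inverse, so the product with
    infinite odds is infinite.\<close>
  have "a < 1" using assms by simp
  then have "a / (1 - a) < \<infinity>"
    using assms by (auto simp: ennreal_divide_eq_top_iff less_top[symmetric] diff_eq_0_iff_ennreal)
  then show ?thesis
    using True by (simp add: ennreal_mult_eq_top_iff ennreal_top_mult)
next
  case False
  obtain s where s: "a = ennreal s" "0 \<le> s"
    using assms by (cases a) auto
  obtain t where t: "b = ennreal t" "0 \<le> t"
    using assms by (cases b) (auto simp: top_unique)
  have st: "0 < s" "s < t" "t < 1"
    using assms False s t by (auto simp: ennreal_less_iff less_le)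
  have "(b / (1 - b)) * inverse (a / (1 - a)) = ennreal ((t / (1 - t)) * inverse (s / (1 - s)))"
    using st ennreal_minus[of s 1] ennreal_minus[of t 1] unfolding s t
    by (simp add: divide_ennreal inverse_ennreal ennreal_mult[symmetric])
  moreover have "1 < (t / (1 - t)) * inverse (s / (1 - s))"
    using st by (simp add: field_simps)
  ultimately show ?thesis by simp
qed

lemma ennreal_one_less_divide:
  fixes a b :: ennreal
  assumes "0 < a" "a < b" "a < \<top>"
  shows "1 < b / a"
  using divide_right_mono_ennreal[of a b a] assms
  by (auto simp: less_le divide_eq_1_ennreal)

theorem lemma6:
  fixes \<upsilon> :: "'p measure" and \<mu> :: "'x measure" and \<nu> :: "'t measure"
    and f :: "'p \<Rightarrow> 'x \<Rightarrow> real" and \<pi> :: "'p \<Rightarrow> real" and \<Upsilon> :: "'p \<Rightarrow> 't"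
    and p q :: "'t \<Rightarrow> real" and x :: 'x and \<gamma> :: real
  defines "P \<equiv> marginal (prior \<upsilon> \<pi>) \<nu> \<Upsilon>"
    and "Q \<equiv> marginal (posterior \<upsilon> f \<pi> x) \<nu> \<Upsilon>"
  defines "C \<equiv> relative_surprise_region Q q p \<gamma>"
  assumes model: "bayesian_model \<upsilon> \<mu> f \<pi>"
    and parameter: "\<Upsilon> \<in> measurable \<upsilon> \<nu>"
    and x: "x \<in> space \<mu>"
    and posterior_exists: "0 < predictive \<upsilon> f \<pi> x" "predictive \<upsilon> f \<pi> x < \<infinity>"
    and prior_density: "is_density \<nu> P p"
    and prior_density_pos: "\<forall>\<tau>\<in>space \<nu>. 0 < p \<tau>"
    and posterior_density: "is_density \<nu> Q q"
    and gamma: "\<gamma> \<in> {0..1}"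
    and nondegenerate: "0 < emeasure P C" "emeasure P C < 1"
  shows "bayes_factor P Q C > 1 \<and> relative_belief_ratio P Q C > 1"
proof -
  interpret bayesian_model \<upsilon> \<mu> f \<pi> by (rule model)
  have "prob_space P"
    unfolding P_def marginal_def prior_def
    by (intro prob_space.prob_space_distr prior_prob) (simp add: parameter)
  \<comment> \<open>The bounds in \<open>posterior_exists\<close> normalise the posterior, and its
    image under \<open>\<Upsilon>\<close> keeps total mass 1.\<close>
  have "prob_space Q"
    unfolding Q_def marginal_def
    by (intro prob_space.prob_space_distr prob_space_posterior[OF model x posterior_exists])
      (simp add: posterior_def parameter)
  interpret Q: prob_space Q by fact
  have space: "space Q = space \<nu>"
    by (simp add: Q_def marginal_def)
  have "(\<lambda>\<tau>. q \<tau> / p \<tau>) \<in> borel_measurable \<nu>"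
    using prior_density posterior_density by (auto simp: is_density_def)
  then have ratio: "(\<lambda>\<tau>. q \<tau> / p \<tau>) \<in> borel_measurable Q"
    by (simp add: Q_def marginal_def)
  have "b \<in> C" if "a \<in> C" "b \<in> space \<nu>" "q a / p a \<le> q b / p b" for a b
    using relative_surprise_region_upper[where p = p, OF Q.finite_measure_axioms ratio] that
    unfolding C_def space by blast
  then have "emeasure P C < emeasure Q C"
    using emeasure_upper_set_less[OF \<open>prob_space P\<close> \<open>prob_space Q\<close> prior_density
        prior_density_pos posterior_density _ nondegenerate] by blast
  moreover have "emeasure P C < \<top>"
    using nondegenerate(2) by (simp add: less_trans[OF _ ennreal_one_less_top])
  \<comment> \<open>The posterior content of \<open>C\<close> may equal 1; the Bayes factor is then
    infinite, a case the odds lemma covers.\<close>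
  ultimately show ?thesis
    unfolding bayes_factor_def relative_belief_ratio_def
    using nondegenerate(1) Q.emeasure_le_1
    by (intro conjI odds_ratio_gt_one ennreal_one_less_divide) auto
qed

end
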